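(* Let $V$ be a finite dimensional euclidean vector space over $\mathbf{R}$, let $1\le p<2$, and let $\gamma:[0,T]\to V$ be a continuous path of finite $p$-variation with image $S_\gamma=\gamma([0,T])$. Let $f,g,h:S_\gamma\to\mathbf{C}$ be Lipschitz functions such that the convex hull of $f(S_\gamma)$ does not contain $0$, and let $\log$ be a continuous branch of the logarithm on $f(S_\gamma)$. Then for any integer $k\ge0$ the function $$s\mapsto I^f_\gamma(E_{k,s},g,h)=\int_\gamma(\log f)^k f^s g\,dh$$ is an entire function of $s\in\mathbf{C}$.
   Context: For $k\in\{0,1,2,\dots\}$ and $s\in\mathbf{C}$, $E_{k,s}$ is the entire function $E_{k,s}(z)=z^ke^{sz}$; for an entire function $E$, $I^f_\gamma(E,g,h)=\int_\gamma(E\circ\log\circ f)\,g\,dh$; and $f^s=\exp(s\log f)$. The integral $\int_\gamma u\,dh$ is the Young integral $\int_0^T(u\circ\gamma)\,d(h\circ\gamma)$ (limit of Riemann–Stieltjes sums), which exists for Lipschitz $u,h$ on $S_\gamma$ (metric inherited from $V$) since $p<2$. *)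

theory Defs
  imports "HOL-Complex_Analysis.Complex_Analysis"
begin

text \<open>
  A subdivision \<open>a = t 0 < t 1 < \<dots> < t n = b\<close>; values of \<open>t\<close> beyond \<open>n\<close> are irrelevant.
  For \<open>a = b\<close> only \<open>n = 0\<close> is possible.
\<close>
definition subdivision :: "real \<Rightarrow> real \<Rightarrow> nat \<Rightarrow> (nat \<Rightarrow> real) \<Rightarrow> bool" where
  "subdivision a b n t \<longleftrightarrow> t 0 = a \<and> t n = b \<and> (\<forall>i<n. t i < t (Suc i))"

definition finite_p_variation ::
    "real \<Rightarrow> real \<Rightarrow> real \<Rightarrow> (real \<Rightarrow> 'a::real_normed_vector) \<Rightarrow> bool" where
  "finite_p_variation p a b x \<longleftrightarrow>
     bdd_above {\<Sum>i<n. norm (x (t (Suc i)) - x (t i)) powr p | n t. subdivision a b n t}"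

text \<open>Limit of Riemann-Stieltjes sums, with arbitrary tags, as the mesh tends to \<open>0\<close>.\<close>
definition has_young_integral ::
    "real \<Rightarrow> real \<Rightarrow> (real \<Rightarrow> complex) \<Rightarrow> (real \<Rightarrow> complex) \<Rightarrow> complex \<Rightarrow> bool" where
  "has_young_integral a b x y I \<longleftrightarrow>
     (\<forall>e>0. \<exists>d>0. \<forall>n t \<xi>.
        subdivision a b n t \<and> (\<forall>i<n. t (Suc i) - t i < d \<and> \<xi> i \<in> {t i..t (Suc i)}) \<longrightarrow>
        norm ((\<Sum>i<n. x (\<xi> i) * (y (t (Suc i)) - y (t i))) - I) < e)"

definition young_integrable ::
    "real \<Rightarrow> real \<Rightarrow> (real \<Rightarrow> complex) \<Rightarrow> (real \<Rightarrow> complex) \<Rightarrow> bool" where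
  "young_integrable a b x y \<longleftrightarrow> (\<exists>I. has_young_integral a b x y I)"

definition young_integral ::
    "real \<Rightarrow> real \<Rightarrow> (real \<Rightarrow> complex) \<Rightarrow> (real \<Rightarrow> complex) \<Rightarrow> complex" where
  "young_integral a b x y = (THE I. has_young_integral a b x y I)"

text \<open>\<open>\<integral>\<^sub>\<gamma> u dh\<close> for a path \<open>\<gamma>\<close> on \<open>[0, T]\<close>.\<close>
definition path_integrable ::
    "real \<Rightarrow> (real \<Rightarrow> 'a) \<Rightarrow> ('a \<Rightarrow> complex) \<Rightarrow> ('a \<Rightarrow> complex) \<Rightarrow> bool" where
  "path_integrable T \<gamma> u h \<longleftrightarrow> young_integrable 0 T (u \<circ> \<gamma>) (h \<circ> \<gamma>)"

definition path_integral ::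
    "real \<Rightarrow> (real \<Rightarrow> 'a) \<Rightarrow> ('a \<Rightarrow> complex) \<Rightarrow> ('a \<Rightarrow> complex) \<Rightarrow> complex" where
  "path_integral T \<gamma> u h = young_integral 0 T (u \<circ> \<gamma>) (h \<circ> \<gamma>)"

definition log_branch_on :: "complex set \<Rightarrow> (complex \<Rightarrow> complex) \<Rightarrow> bool" where
  "log_branch_on W L \<longleftrightarrow> continuous_on W L \<and> (\<forall>w\<in>W. exp (L w) = w)"

text \<open>\<open>f\<^sup>s\<close> with respect to the branch \<open>L\<close>.\<close>
definition branch_power ::
    "(complex \<Rightarrow> complex) \<Rightarrow> ('a \<Rightarrow> complex) \<Rightarrow> complex \<Rightarrow> 'a \<Rightarrow> complex" where
  "branch_power L f s v = exp (s * L (f v))"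

definition E_fun :: "nat \<Rightarrow> complex \<Rightarrow> complex \<Rightarrow> complex" where
  "E_fun k s z = z ^ k * exp (s * z)"

text \<open>\<open>I\<^sup>f\<^sub>\<gamma>(E, g, h)\<close>, with the branch \<open>L\<close> of the logarithm made explicit.\<close>
definition I_int ::
    "real \<Rightarrow> (real \<Rightarrow> 'a) \<Rightarrow> (complex \<Rightarrow> complex) \<Rightarrow> ('a \<Rightarrow> complex) \<Rightarrow>
     (complex \<Rightarrow> complex) \<Rightarrow> ('a \<Rightarrow> complex) \<Rightarrow> ('a \<Rightarrow> complex) \<Rightarrow> complex" where
  "I_int T \<gamma> L f E g h = path_integral T \<gamma> (\<lambda>v. (E \<circ> L \<circ> f) v * g v) h"

end

theory Submission
  imports Defs
begin

text \<open>
  The function in question is a locally uniform limit of entire functions. For a fixed tagged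
  subdivision the Riemann-Stieltjes sum of \<open>(log f)\<^sup>k f\<^sup>s g\<close> against \<open>h\<close> is a finite linear combination of
  the entire functions \<open>s \<mapsto> E_fun k s (L (f (\<gamma> u)))\<close>. So it is enough that these sums converge to
  the Young integral as the mesh tends to \<open>0\<close>, uniformly for \<open>s\<close> in a bounded set.

  The convergence is Young's theorem in a quantitative form: if two functions are Lipschitz along a
  continuous path \<open>\<gamma>\<close> of finite \<open>p\<close>-variation, \<open>p < 2\<close>, then the mesh that makes all Riemann-Stieltjes sums
  agree up to \<open>e\<close> depends only on \<open>\<gamma>\<close>, \<open>e\<close> and the two Lipschitz constants
  (\<open>rs_sums_uniformly_cauchy\<close>). Its core is the sewing estimate \<open>left_sum_sewing\<close>: the
  \<open>p\<close>-variation of \<open>\<gamma>\<close> over subintervals is a superadditive function \<open>w\<close>, products of two increments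
  over \<open>[r, v]\<close> are bounded by a multiple of \<open>w r v powr \<theta>\<close> with \<open>\<theta> > 1\<close>, and therefore refining a
  partition of \<open>[r, v]\<close>, however often, changes the sum by at most a multiple of \<open>w r v powr \<theta>\<close>. The
  multiple is small for small mesh because \<open>2 / p > 1\<close> leaves room to lower the exponent in exchange for
  a factor from the uniform continuity of \<open>\<gamma>\<close> (\<open>small_increments\<close>).

  To apply this, the integrand must be Lipschitz along \<open>\<gamma>\<close> with a constant that is locally uniform in
  \<open>s\<close>. A continuous branch of the logarithm on the compact set of values of \<open>f\<close> is Lipschitz, since
  \<open>exp\<close> has a locally Lipschitz inverse (\<open>log_branch_lipschitz\<close>), and \<open>E_fun k s\<close> has a derivative that is
  bounded uniformly for bounded \<open>s\<close> on bounded discs (\<open>E_fun_lipschitz\<close>).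
\<close>

section \<open>Sums over consecutive entries\<close>

text \<open>
  Partitions are represented by lists sorted in the weak sense. Repeated points contribute
  nothing to the sums below, and allowing them makes concatenation and merging of partitions
  the plain list operations \<^term>\<open>(@)\<close> and \<^term>\<open>sort\<close>.
\<close>
fun adj_sum :: "('b \<Rightarrow> 'b \<Rightarrow> 'c::comm_monoid_add) \<Rightarrow> 'b list \<Rightarrow> 'c" where
  "adj_sum F (a # b # ts) = F a b + adj_sum F (b # ts)"
| "adj_sum F ts = 0"

lemma adj_sum_split: "adj_sum F (l @ u # r) = adj_sum F (l @ [u]) + adj_sum F (u # r)"
proof (induction l)
  case (Cons a l)
  then show ?case
    by (cases l) (auto simp: add.assoc)
qed simp

lemma adj_sum_append_ge:
  fixes F :: "'b \<Rightarrow> 'b \<Rightarrow> real"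
  assumes "\<And>u v. 0 \<le> F u v"
  shows "adj_sum F l + adj_sum F r \<le> adj_sum F (l @ r)"
proof (induction l rule: induct_list012)
  case (2 x)
  then show ?case
    using assms by (cases r) auto
qed auto

lemma adj_sum_mono:
  fixes F G :: "'b \<Rightarrow> 'b \<Rightarrow> real"
  assumes "successively (\<lambda>u v. F u v \<le> G u v) ts"
  shows "adj_sum F ts \<le> adj_sum G ts"
  using assms by (induction ts rule: induct_list012) (auto intro: add_mono)

lemma adj_sum_mult:
  fixes F :: "'b \<Rightarrow> 'b \<Rightarrow> real"
  shows "adj_sum (\<lambda>u v. c * F u v) ts = c * adj_sum F ts"
  by (induction F ts rule: adj_sum.induct) (auto simp: algebra_simps)

lemma adj_sum_map_upt:
  "adj_sum F (map t [0..<Suc n]) = (\<Sum>i<n. F (t i) (t (Suc i)))"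
proof (induction n)
  case (Suc n)
  have "adj_sum F (map t [0..<n] @ t n # [t (Suc n)]) =
      adj_sum F (map t [0..<n] @ [t n]) + F (t n) (t (Suc n))"
    by (subst adj_sum_split) simp
  with Suc show ?case
    by simp
qed simp

lemma successively_map_upt:
  "successively P (map t [0..<Suc n]) \<longleftrightarrow> (\<forall>i<n. P (t i) (t (Suc i)))"
  unfolding successively_conv_nth by (auto simp del: upt_Suc)

abbreviation left_sum :: "(real \<Rightarrow> complex) \<Rightarrow> (real \<Rightarrow> complex) \<Rightarrow> real list \<Rightarrow> complex" where
  "left_sum x y \<equiv> adj_sum (\<lambda>u v. x u * (y v - y u))"

section \<open>Controls\<close>

text \<open>
  A control measures the size of a subinterval; superadditivity is what allows local errors of
  order \<open>w u v powr \<theta>\<close> with \<open>\<theta> > 1\<close> to be summed over a partition.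
\<close>
definition control :: "real \<Rightarrow> real \<Rightarrow> (real \<Rightarrow> real \<Rightarrow> real) \<Rightarrow> bool" where
  "control a b w \<longleftrightarrow>
     (\<forall>s t. a \<le> s \<and> s \<le> t \<and> t \<le> b \<longrightarrow> 0 \<le> w s t) \<and>
     (\<forall>s u t. a \<le> s \<and> s \<le> u \<and> u \<le> t \<and> t \<le> b \<longrightarrow> w s u + w u t \<le> w s t)"

lemma control_nonneg: "control a b w \<Longrightarrow> a \<le> s \<Longrightarrow> s \<le> t \<Longrightarrow> t \<le> b \<Longrightarrow> 0 \<le> w s t"
  unfolding control_def by blast

lemma control_superadd:
  "control a b w \<Longrightarrow> a \<le> s \<Longrightarrow> s \<le> u \<Longrightarrow> u \<le> t \<Longrightarrow> t \<le> b \<Longrightarrow> w s u + w u t \<le> w s t"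
  unfolding control_def by blast

lemma control_subinterval: "control a b w \<Longrightarrow> a \<le> a' \<Longrightarrow> b' \<le> b \<Longrightarrow> control a' b' w"
  unfolding control_def by auto

lemma control_refl: "control a b w \<Longrightarrow> a \<le> s \<Longrightarrow> s \<le> b \<Longrightarrow> w s s = 0"
  using control_superadd[of a b w s s s] control_nonneg[of a b w s s] by simp

lemma control_mono:
  assumes "control a b w" "a \<le> s" "s \<le> s'" "s' \<le> t'" "t' \<le> t" "t \<le> b"
  shows "w s' t' \<le> w s t"
  using control_superadd[of a b w s s' t'] control_superadd[of a b w s t' t]
    control_nonneg[of a b w s s'] control_nonneg[of a b w t' t] assms by linarith

lemma hd_le_sorted: "sorted ts \<Longrightarrow> u \<in> set ts \<Longrightarrow> hd ts \<le> u"
  by (cases ts) auto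

lemma sorted_le_last: "sorted ts \<Longrightarrow> u \<in> set ts \<Longrightarrow> u \<le> last ts"
  by (induction ts) auto

lemma sorted_ends:
  assumes "sorted ts" "ts \<noteq> []" "set ts \<subseteq> {a..b}"
  shows "a \<le> hd ts" "hd ts \<le> last ts" "last ts \<le> b"
proof -
  have "hd ts \<in> {a..b}" "last ts \<in> {a..b}"
    using assms by (meson hd_in_set last_in_set subsetD)+
  then show "a \<le> hd ts" "last ts \<le> b"
    by auto
  show "hd ts \<le> last ts"
    using assms by (simp add: hd_le_sorted)
qed

lemma adj_sum_control_le:
  assumes "control a b w" "sorted ts" "ts \<noteq> []" "set ts \<subseteq> {a..b}"
  shows "adj_sum w ts \<le> w (hd ts) (last ts)"
  using assms(2-)
proof (induction ts rule: induct_list012)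
  case (2 t)
  then show ?case
    using control_nonneg[OF assms(1), of t t] by auto
next
  case (3 u v ts)
  have "w u v + w v (last (v # ts)) \<le> w u (last (v # ts))"
    using 3(3,5) sorted_le_last[of "v # ts" v] last_in_set[of "v # ts"]
    by (intro control_superadd[OF assms(1)]) auto
  with 3 show ?case
    by auto
qed simp

text \<open>
  Factor \<open>w u v powr \<theta> = w u v powr (\<theta> - 1) * w u v\<close>, bound the first factor by its value on the
  whole interval, and sum the second by superadditivity.
\<close>
lemma adj_sum_control_powr_le:
  assumes w: "control a b w" and "1 \<le> \<theta>" "sorted ts" "ts \<noteq> []" "set ts \<subseteq> {a..b}"
  shows "adj_sum (\<lambda>u v. w u v powr \<theta>) ts \<le> w (hd ts) (last ts) powr \<theta>"
proof -
  define W where "W = w (hd ts) (last ts)"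
  have ends: "a \<le> hd ts" "hd ts \<le> last ts" "last ts \<le> b"
    using sorted_ends[OF assms(3-5)] by auto
  then have W: "0 \<le> W"
    unfolding W_def using control_nonneg[OF w] by auto
  have "w u v powr \<theta> \<le> W powr (\<theta> - 1) * w u v" if "u \<in> set ts" "v \<in> set ts" "u \<le> v" for u v
  proof -
    have uv: "hd ts \<le> u" "v \<le> last ts"
      using that assms hd_le_sorted sorted_le_last by auto
    have nonneg: "0 \<le> w u v"
      using that assms by (intro control_nonneg[OF w]) auto
    have "w u v powr \<theta> = w u v powr (\<theta> - 1) * w u v"
      using nonneg by (cases "w u v = 0") (auto simp: powr_diff)
    also have "\<dots> \<le> W powr (\<theta> - 1) * w u v"
      using nonneg assms(2) ends uv that unfolding W_def
      by (intro mult_right_mono powr_mono2 control_mono[OF w]) auto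
    finally show ?thesis .
  qed
  then have "successively (\<lambda>u v. w u v powr \<theta> \<le> W powr (\<theta> - 1) * w u v) ts"
    using successively_if_sorted_wrt[OF \<open>sorted ts\<close>]
    by (auto simp: successively_conv_nth)
  then have "adj_sum (\<lambda>u v. w u v powr \<theta>) ts \<le> W powr (\<theta> - 1) * adj_sum w ts"
    unfolding adj_sum_mult[symmetric] by (rule adj_sum_mono)
  also have "\<dots> \<le> W powr (\<theta> - 1) * W"
    using adj_sum_control_le[OF w assms(3-5)] by (intro mult_left_mono) (auto simp: W_def)
  also have "\<dots> = W powr \<theta>"
    using W by (cases "W = 0") (auto simp: powr_diff)
  finally show ?thesis
    unfolding W_def .
qed

section \<open>Sewing\<close>

text \<open>
  The split point is the last position of the initial run of entries that satisfy \<open>P\<close>, or the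
  last but one entry if that run is the whole list.
\<close>
lemma list_split_last:
  assumes "P (hd ts)" "ts = t0 # t1 # ts'"
  obtains l u v r where "ts = l @ u # v # r" "P u" "r = [] \<or> \<not> P v"
proof -
  have "\<exists>l u v r. ts = l @ u # v # r \<and> P u \<and> (r = [] \<or> \<not> P v)"
    using assms
  proof (induction ts' arbitrary: ts t0 t1)
    case Nil
    then show ?case
      by (metis append_Nil list.sel(1))
  next
    case (Cons t2 ts')
    show ?case
    proof (cases "P t1")
      case True
      with Cons.IH[of "t1 # t2 # ts'" t1 t2] obtain l u v r
        where "t1 # t2 # ts' = l @ u # v # r" "P u" "r = [] \<or> \<not> P v"
        by auto
      then have "ts = (t0 # l) @ u # v # r"
        using Cons.prems by simp
      with \<open>P u\<close> \<open>r = [] \<or> \<not> P v\<close> show ?thesis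
        by blast
    next
      case False
      with Cons.prems have "ts = [] @ t0 # t1 # t2 # ts'" "P t0"
        by auto
      with False show ?thesis
        by blast
    qed
  qed
  with that show ?thesis
    by blast
qed

text \<open>
  The solution \<open>K\<close> of \<open>2 * (1/2) powr \<theta> * K + 2 = K\<close>, the equation which closes the induction in
  the sewing estimate: two halves, each with half of the control, and two elementary errors.
\<close>
definition sewing_const :: "real \<Rightarrow> real" where
  "sewing_const \<theta> = 2 / (1 - 2 powr (1 - \<theta>))"

lemma sewing_const:
  assumes "1 < \<theta>"
  shows "0 \<le> sewing_const \<theta>" "2 * (1/2) powr \<theta> * sewing_const \<theta> + 2 = sewing_const \<theta>"
proof -
  have *: "2 powr (1 - \<theta>) < 2 powr 0"
    using assms by (intro powr_less_mono) auto
  then show "0 \<le> sewing_const \<theta>"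
    unfolding sewing_const_def by auto
  have "2 * (1/2) powr \<theta> = 2 powr (1 - \<theta>)"
    by (simp add: powr_divide powr_diff)
  then show "2 * (1/2) powr \<theta> * sewing_const \<theta> + 2 = sewing_const \<theta>"
    using * assms unfolding sewing_const_def by (simp add: divide_simps)
qed

text \<open>
  This is Young's estimate. Cut the partition at the consecutive points \<open>u\<close>, \<open>v\<close> where the control
  measured from the left end passes half of its total \<open>W\<close>. By superadditivity both outer pieces
  have control at most \<open>W / 2\<close>, so by induction each has error at most
  \<open>K * C * (W / 2) powr \<theta>\<close>, and joining the three pieces costs two products of increments, each
  at most \<open>C * W powr \<theta>\<close>. As \<open>2 * (1/2) powr \<theta> < 1\<close>, a constant \<open>K\<close> that does not depend on the
  number of points closes the induction.
\<close>
lemma left_sum_sewing: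
  assumes w: "control a b w" and \<theta>: "1 < \<theta>" and C: "0 \<le> C"
    and xy: "\<And>r u v. a \<le> r \<Longrightarrow> r \<le> u \<Longrightarrow> u \<le> v \<Longrightarrow> v \<le> b \<Longrightarrow>
               norm (x u - x r) * norm (y v - y u) \<le> C * w r v powr \<theta>"
    and "sorted ts" "ts \<noteq> []" "set ts \<subseteq> {a..b}"
  shows "norm (left_sum x y ts - x (hd ts) * (y (last ts) - y (hd ts)))
           \<le> sewing_const \<theta> * C * w (hd ts) (last ts) powr \<theta>"
  using assms(5-)
proof (induction ts rule: length_induct)
  case (1 ts)
  define K where "K = sewing_const \<theta>"
  have K: "0 \<le> K" "2 * (1/2) powr \<theta> * K + 2 = K"
    using sewing_const[OF \<theta>] by (auto simp: K_def)
  consider t where "ts = [t]" | t0 t1 ts' where "ts = t0 # t1 # ts'"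
    using 1(3) by (metis neq_Nil_conv)
  then show ?case
  proof cases
    case 1
    then show ?thesis
      using K C by (simp add: K_def)
  next
    case 2
    define p q where "p = hd ts" and "q = last ts"
    define W where "W = w p q"
    have pq: "a \<le> p" "p \<le> q" "q \<le> b"
      using sorted_ends[OF 1(2-4)] by (auto simp: p_def q_def)
    have W: "0 \<le> W"
      unfolding W_def using control_nonneg[OF w] pq by auto
    have "w p (hd ts) \<le> W / 2"
      using control_refl[OF w, of p] pq W by (simp add: p_def)
    then obtain l u v r where ts: "ts = l @ u # v # r"
      and u: "w p u \<le> W / 2" and v: "r = [] \<or> \<not> w p v \<le> W / 2"
      using list_split_last[of "\<lambda>t. w p t \<le> W / 2" ts, OF _ 2] by metis
    have ord: "p \<le> u" "u \<le> v" "v \<le> q"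
      using 1(2) hd_le_sorted[of ts u] sorted_le_last[of ts v]
      by (auto simp: p_def q_def ts sorted_append)
    \<comment> \<open>If \<open>v\<close> is the last point, the right piece is a single point of control \<open>0\<close>.\<close>
    have "w v q \<le> W / 2"
    proof (cases "r = []")
      case True
      then have "v = q"
        by (simp add: q_def ts)
      then show ?thesis
        using control_refl[OF w, of q] pq W by simp
    next
      case False
      with v have "W / 2 < w p v"
        by simp
      moreover have "w p v + w v q \<le> W"
        unfolding W_def using ord pq by (intro control_superadd[OF w]) auto
      ultimately show ?thesis
        by simp
    qed
    have hds: "hd (l @ [u]) = p" "last (v # r) = q"
      by (auto simp: p_def q_def ts hd_append)
    have half: "K * C * z powr \<theta> \<le> K * C * (W / 2) powr \<theta>" if "z \<le> W / 2" "0 \<le> z" for z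
      using that \<theta> K C by (intro mult_left_mono powr_mono2) auto
    have "norm (left_sum x y (l @ [u]) - x p * (y u - y p)) \<le> K * C * w p u powr \<theta>"
      using 1(1)[rule_format, of "l @ [u]"] 1(2-) hds
      by (auto simp: ts K_def sorted_append)
    also have "\<dots> \<le> K * C * (W / 2) powr \<theta>"
      using u ord pq by (intro half control_nonneg[OF w]) auto
    finally have left: "norm (left_sum x y (l @ [u]) - x p * (y u - y p)) \<le> K * C * (W / 2) powr \<theta>" .
    have "norm (left_sum x y (v # r) - x v * (y q - y v)) \<le> K * C * w v q powr \<theta>"
      using 1(1)[rule_format, of "v # r"] 1(2-) hds
      by (auto simp: ts K_def sorted_append)
    also have "\<dots> \<le> K * C * (W / 2) powr \<theta>"
      using \<open>w v q \<le> W / 2\<close> ord pq by (intro half control_nonneg[OF w]) auto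
    finally have right: "norm (left_sum x y (v # r) - x v * (y q - y v)) \<le> K * C * (W / 2) powr \<theta>" .
    have W_mono: "C * w p t powr \<theta> \<le> C * W powr \<theta>" if "p \<le> t" "t \<le> q" for t
      using that pq \<theta> C control_mono[OF w, of p p t q] control_nonneg[OF w, of p t]
      unfolding W_def by (intro mult_left_mono powr_mono2) auto
    have mid1: "norm ((x u - x p) * (y v - y u)) \<le> C * W powr \<theta>"
      using xy[of p u v] W_mono[of v] ord pq by (auto simp: norm_mult)
    have mid2: "norm ((x v - x p) * (y q - y v)) \<le> C * W powr \<theta>"
      using xy[of p v q] W_mono[of q] ord pq by (auto simp: norm_mult)
    have "left_sum x y ts = left_sum x y (l @ [u]) + x u * (y v - y u) + left_sum x y (v # r)"
      unfolding ts by (subst adj_sum_split) simp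
    then have "left_sum x y ts - x p * (y q - y p) =
        (left_sum x y (l @ [u]) - x p * (y u - y p)) + (left_sum x y (v # r) - x v * (y q - y v))
        + (x u - x p) * (y v - y u) + (x v - x p) * (y q - y v)"
      by (simp add: algebra_simps)
    also have "norm \<dots> \<le> 2 * (K * C * (W / 2) powr \<theta>) + 2 * (C * W powr \<theta>)"
      using norm_triangle_mono[OF norm_triangle_mono[OF norm_triangle_mono[OF left right] mid1] mid2]
      by (simp add: mult_ac)
    also have "(W / 2) powr \<theta> = (1/2) powr \<theta> * W powr \<theta>"
      by (metis mult.commute mult.left_neutral powr_mult times_divide_eq_right)
    also have "2 * (K * C * ((1/2) powr \<theta> * W powr \<theta>)) + 2 * (C * W powr \<theta>) =
               (2 * (1/2) powr \<theta> * K + 2) * C * W powr \<theta>"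
      by (simp add: algebra_simps)
    finally show ?thesis
      unfolding K(2) by (simp add: K_def W_def p_def q_def)
  qed
qed

text \<open>
  Within each interval of the coarse partition \<open>P\<close> the refinement \<open>Q\<close> is itself a partition, to which
  the sewing estimate applies. Since all these intervals are shorter than \<open>\<delta>\<close>, the bound on products
  of increments is needed only at scales below \<open>\<delta>\<close>, where \<open>C\<close> can be taken small.
\<close>
lemma left_sum_refine:
  assumes w: "control a b w" and \<theta>: "1 < \<theta>" and C: "0 \<le> C" and \<delta>: "0 < \<delta>"
    and xy: "\<And>r u v. a \<le> r \<Longrightarrow> r \<le> u \<Longrightarrow> u \<le> v \<Longrightarrow> v \<le> b \<Longrightarrow> v - r < \<delta> \<Longrightarrow>
               norm (x u - x r) * norm (y v - y u) \<le> C * w r v powr \<theta>"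
    and "sorted P" "P \<noteq> []" "successively (\<lambda>u v. v - u < \<delta>) P"
    and "sorted Q" "set Q \<subseteq> {a..b}" "set P \<subseteq> set Q" "hd Q = hd P" "last Q = last P"
  shows "norm (left_sum x y Q - left_sum x y P)
           \<le> sewing_const \<theta> * C * adj_sum (\<lambda>u v. w u v powr \<theta>) P"
  using assms(6-)
proof (induction P arbitrary: Q rule: induct_list012)
  case (2 t)
  have "Q \<noteq> []"
    using 2 by auto
  have "norm (left_sum x y Q - x t * (y t - y t)) \<le> sewing_const \<theta> * C * w t t powr \<theta>"
  proof -
    have *: "set Q \<subseteq> {t..t}"
      using 2 hd_le_sorted[of Q] sorted_le_last[of Q] by force
    have "t \<in> {a..b}"
      using 2 by auto
    then have "norm (left_sum x y Q - x (hd Q) * (y (last Q) - y (hd Q)))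
        \<le> sewing_const \<theta> * C * w (hd Q) (last Q) powr \<theta>"
      using 2 * \<delta> \<open>Q \<noteq> []\<close>
      by (intro left_sum_sewing[OF control_subinterval[OF w, of t t] \<theta> C]) (auto intro!: xy)
    then show ?thesis
      using 2 by simp
  qed
  moreover have "w t t = 0"
    using 2 by (intro control_refl[OF w]) auto
  ultimately show ?case
    using \<theta> by simp
next
  case (3 s p P)
  have "p \<in> set Q"
    using 3 by auto
  then obtain Q1 Q2 where Q: "Q = Q1 @ p # Q2"
    by (auto simp: in_set_conv_decomp)
  have sp: "a \<le> s" "s \<le> p" "p \<le> b" "p - s < \<delta>"
    using 3 by auto
  have "set (p # P) \<subseteq> set (p # Q2)"
  proof
    fix r assume r: "r \<in> set (p # P)"
    then have "r \<in> set Q" "p \<le> r"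
      using 3 by auto
    moreover have "r \<le> p" if "r \<in> set Q1"
      using that 3(6) by (auto simp: Q sorted_append)
    ultimately show "r \<in> set (p # Q2)"
      by (auto simp: Q)
  qed
  then have rest: "norm (left_sum x y (p # Q2) - left_sum x y (p # P))
           \<le> sewing_const \<theta> * C * adj_sum (\<lambda>u v. w u v powr \<theta>) (p # P)"
    using 3 by (intro "3.IH"(2)) (auto simp: Q sorted_append)
  have hd: "hd (Q1 @ [p]) = s"
    using 3(9) by (cases Q1) (auto simp: Q)
  have "sorted (Q1 @ [p])"
    using 3(6) by (auto simp: Q sorted_append)
  then have "set (Q1 @ [p]) \<subseteq> {s..p}"
    using hd hd_le_sorted[of "Q1 @ [p]"] sorted_le_last[of "Q1 @ [p]"] by fastforce
  then have "norm (left_sum x y (Q1 @ [p]) - x (hd (Q1 @ [p])) * (y (last (Q1 @ [p])) - y (hd (Q1 @ [p]))))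
        \<le> sewing_const \<theta> * C * w (hd (Q1 @ [p])) (last (Q1 @ [p])) powr \<theta>"
    using sp \<open>sorted (Q1 @ [p])\<close>
    by (intro left_sum_sewing[OF control_subinterval[OF w, of s p] \<theta> C]) (auto intro!: xy)
  then have first: "norm (left_sum x y (Q1 @ [p]) - x s * (y p - y s)) \<le> sewing_const \<theta> * C * w s p powr \<theta>"
    by (simp only: hd last_snoc)
  have "left_sum x y Q - left_sum x y (s # p # P) =
      (left_sum x y (Q1 @ [p]) - x s * (y p - y s)) + (left_sum x y (p # Q2) - left_sum x y (p # P))"
    unfolding Q by (subst adj_sum_split) simp
  also have "norm \<dots> \<le> sewing_const \<theta> * C * w s p powr \<theta>
      + sewing_const \<theta> * C * adj_sum (\<lambda>u v. w u v powr \<theta>) (p # P)"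
    by (rule norm_triangle_mono[OF first rest])
  also have "\<dots> = sewing_const \<theta> * C * adj_sum (\<lambda>u v. w u v powr \<theta>) (s # p # P)"
    by (simp add: algebra_simps)
  finally show ?case .
qed simp

section \<open>The p-variation of a path\<close>

abbreviation p_sum :: "real \<Rightarrow> (real \<Rightarrow> 'a::real_normed_vector) \<Rightarrow> real list \<Rightarrow> real" where
  "p_sum p \<gamma> \<equiv> adj_sum (\<lambda>u v. norm (\<gamma> v - \<gamma> u) powr p)"

definition p_var :: "real \<Rightarrow> (real \<Rightarrow> 'a::real_normed_vector) \<Rightarrow> real \<Rightarrow> real \<Rightarrow> real" where
  "p_var p \<gamma> s t = (SUP ts\<in>{ts. sorted ts \<and> set ts \<subseteq> {s..t}}. p_sum p \<gamma> ts)"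

text \<open>
  Removing repetitions turns a weakly sorted list into a subdivision. Thus suprema over sorted
  lists are controlled by the bound in the definition of finite \<open>p\<close>-variation.
\<close>
lemma sorted_list_subdivision:
  assumes "sorted ts" "ts \<noteq> []" "\<And>u. F u u = 0"
  shows "\<exists>n t. subdivision (hd ts) (last ts) n t \<and> adj_sum F ts = (\<Sum>i<n. F (t i) (t (Suc i)))"
  using assms(1,2)
proof (induction ts rule: induct_list012)
  case (2 x)
  show ?case
    by (rule exI[of _ 0], rule exI[of _ "\<lambda>_. x"]) (simp add: subdivision_def)
next
  case (3 a b ts)
  then obtain n t where t: "subdivision b (last (b # ts)) n t"
    and sum: "adj_sum F (b # ts) = (\<Sum>i<n. F (t i) (t (Suc i)))"
    by auto
  show ?case
  proof (cases "a = b")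
    case True
    with t sum assms(3) show ?thesis
      by (intro exI[of _ n] exI[of _ t]) simp
  next
    case False
    with 3 have "a < b"
      by auto
    then have "subdivision a (last (b # ts)) (Suc n) (case_nat a t)"
      using t by (auto simp: subdivision_def less_Suc_eq_0_disj)
    moreover have "adj_sum F (a # b # ts) =
        (\<Sum>i<Suc n. F (case_nat a t i) (case_nat a t (Suc i)))"
      using sum t by (subst sum.lessThan_Suc_shift) (simp add: subdivision_def)
    ultimately show ?thesis
      by (metis last_ConsR list.distinct(1) list.sel(1))
  qed
qed simp

lemma bdd_above_p_sums:
  assumes "finite_p_variation p a b \<gamma>" "a \<le> s" "s \<le> t" "t \<le> b"
  shows "bdd_above (p_sum p \<gamma> ` {ts. sorted ts \<and> set ts \<subseteq> {s..t}})"
proof -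
  obtain M where M: "\<And>n \<tau>. subdivision a b n \<tau> \<Longrightarrow>
      (\<Sum>i<n. norm (\<gamma> (\<tau> (Suc i)) - \<gamma> (\<tau> i)) powr p) \<le> M"
    using assms(1) unfolding finite_p_variation_def bdd_above_def by blast
  have "p_sum p \<gamma> ts \<le> M" if "sorted ts" "set ts \<subseteq> {s..t}" for ts
  proof -
    \<comment> \<open>Adding both end points only increases the sum and makes the list a partition of the whole interval.\<close>
    have "sorted (a # ts @ [b])"
      using that assms by (auto simp: sorted_append)
    from sorted_list_subdivision[OF this, of "\<lambda>u v. norm (\<gamma> v - \<gamma> u) powr p"] M
    have "p_sum p \<gamma> ([a] @ ts @ [b]) \<le> M"
      by auto
    moreover have "p_sum p \<gamma> [a] + p_sum p \<gamma> (ts @ [b]) \<le> p_sum p \<gamma> ([a] @ ts @ [b])"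
      by (rule adj_sum_append_ge) simp
    moreover have "p_sum p \<gamma> ts + p_sum p \<gamma> [b] \<le> p_sum p \<gamma> (ts @ [b])"
      by (rule adj_sum_append_ge) simp
    ultimately show ?thesis
      by simp
  qed
  then show ?thesis
    by (intro bdd_aboveI[of _ M]) auto
qed

lemma p_sum_le_p_var:
  assumes "finite_p_variation p a b \<gamma>" "a \<le> s" "s \<le> t" "t \<le> b" "sorted ts" "set ts \<subseteq> {s..t}"
  shows "p_sum p \<gamma> ts \<le> p_var p \<gamma> s t"
  unfolding p_var_def using assms by (intro cSUP_upper bdd_above_p_sums) auto

text \<open>
  Lists in adjacent intervals concatenate to a list in the union, and the \<open>p\<close>-sum of the
  concatenation is at least the sum of the two \<open>p\<close>-sums.
\<close>
lemma control_p_var: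
  assumes "finite_p_variation p a b \<gamma>"
  shows "control a b (p_var p \<gamma>)"
  unfolding control_def
proof (intro conjI allI impI)
  fix s t assume "a \<le> s \<and> s \<le> t \<and> t \<le> b"
  then show "0 \<le> p_var p \<gamma> s t"
    using p_sum_le_p_var[OF assms, of s t "[]"] by simp
next
  fix s u t assume st: "a \<le> s \<and> s \<le> u \<and> u \<le> t \<and> t \<le> b"
  have "p_sum p \<gamma> l + p_sum p \<gamma> r \<le> p_var p \<gamma> s t"
    if "sorted l" "set l \<subseteq> {s..u}" "sorted r" "set r \<subseteq> {u..t}" for l r
  proof -
    have "p_sum p \<gamma> l + p_sum p \<gamma> r \<le> p_sum p \<gamma> (l @ r)"
      by (rule adj_sum_append_ge) simp
    also have "\<dots> \<le> p_var p \<gamma> s t"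
      using that st by (intro p_sum_le_p_var[OF assms]) (force simp: sorted_append)+
    finally show ?thesis .
  qed
  note sums = this
  have "p_var p \<gamma> s u \<le> p_var p \<gamma> s t - p_sum p \<gamma> r"
    if "sorted r" "set r \<subseteq> {u..t}" for r
    unfolding p_var_def[of p \<gamma> s u]
  proof (rule cSUP_least)
    show "{ts. sorted ts \<and> set ts \<subseteq> {s..u}} \<noteq> {}"
      by (rule ex_in_conv[THEN iffD1], rule exI[of _ "[]"]) simp
  qed (use sums that in force)
  note left = this
  have "p_var p \<gamma> u t \<le> p_var p \<gamma> s t - p_var p \<gamma> s u"
    unfolding p_var_def[of p \<gamma> u t]
  proof (rule cSUP_least)
    show "{ts. sorted ts \<and> set ts \<subseteq> {u..t}} \<noteq> {}"
      by (rule ex_in_conv[THEN iffD1], rule exI[of _ "[]"]) simp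
  qed (use left in force)
  then show "p_var p \<gamma> s u + p_var p \<gamma> u t \<le> p_var p \<gamma> s t"
    by simp
qed

lemma norm_powr_le_p_var:
  assumes "finite_p_variation p a b \<gamma>" "a \<le> r" "v \<le> b" "u \<in> {r..v}" "u' \<in> {r..v}"
  shows "norm (\<gamma> u - \<gamma> u') powr p \<le> p_var p \<gamma> r v"
proof -
  have *: "norm (\<gamma> z' - \<gamma> z) powr p \<le> p_var p \<gamma> r v" if "r \<le> z" "z \<le> z'" "z' \<le> v" for z z'
    using p_sum_le_p_var[OF assms(1), of r v "[z, z']"] that assms by simp
  show ?thesis
    using *[of u u'] *[of u' u] assms by (cases "u \<le> u'") (auto simp: norm_minus_commute)
qed

text \<open>
  The \<open>p\<close>-variation alone gives \<open>norm (\<gamma> u - \<gamma> u') \<le> w r v powr (1 / p)\<close> with constant \<open>1\<close>.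
  Interpolating with the uniform smallness of increments over short intervals, by writing
  \<open>z = z powr (1 - p / q) * z powr (p / q)\<close>, trades a little of the exponent for an arbitrarily small
  constant \<open>\<eta>\<close>. It is this constant that makes Riemann-Stieltjes sums converge as the mesh tends
  to \<open>0\<close>.
\<close>
lemma small_increments:
  assumes var: "finite_p_variation p a b \<gamma>" and "1 \<le> p" "p < q"
    and cont: "continuous_on {a..b} \<gamma>" and "0 < \<eta>"
  obtains \<delta> where "0 < \<delta>"
    "\<And>r v u u'. a \<le> r \<Longrightarrow> v \<le> b \<Longrightarrow> v - r < \<delta> \<Longrightarrow> u \<in> {r..v} \<Longrightarrow> u' \<in> {r..v} \<Longrightarrow>
       norm (\<gamma> u - \<gamma> u') \<le> \<eta> * p_var p \<gamma> r v powr (1 / q)"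
proof -
  define \<kappa> where "\<kappa> = 1 - p / q"
  have \<kappa>: "0 < \<kappa>"
    using assms by (simp add: \<kappa>_def)
  define \<epsilon> where "\<epsilon> = \<eta> powr (1 / \<kappa>)"
  have "0 < \<epsilon>"
    using \<open>0 < \<eta>\<close> by (simp add: \<epsilon>_def)
  then obtain \<delta> where \<delta>: "0 < \<delta>"
    "\<And>u u'. u \<in> {a..b} \<Longrightarrow> u' \<in> {a..b} \<Longrightarrow> dist u u' < \<delta> \<Longrightarrow> dist (\<gamma> u) (\<gamma> u') < \<epsilon>"
    using compact_uniformly_continuous[OF cont] unfolding uniformly_continuous_on_def
    by (metis compact_Icc)
  show ?thesis
  proof (rule that[OF \<open>0 < \<delta>\<close>])
    fix r v u u'
    assume rv: "a \<le> r" "v \<le> b" "v - r < \<delta>" and u: "u \<in> {r..v}" "u' \<in> {r..v}"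
    define z where "z = norm (\<gamma> u - \<gamma> u')"
    have "z < \<epsilon>"
      using \<delta>(2)[of u u'] rv u by (auto simp: z_def dist_norm)
    have "z powr p \<le> p_var p \<gamma> r v"
      unfolding z_def by (rule norm_powr_le_p_var[OF var rv(1,2) u])
    have "0 \<le> z"
      by (simp add: z_def)
    have "z = z powr \<kappa> * (z powr p) powr (1 / q)"
      using \<open>0 \<le> z\<close> by (cases "z = 0") (auto simp: powr_powr \<kappa>_def simp flip: powr_add)
    also have "\<dots> \<le> \<epsilon> powr \<kappa> * p_var p \<gamma> r v powr (1 / q)"
      using \<open>z < \<epsilon>\<close> \<open>z powr p \<le> _\<close> \<open>0 \<le> z\<close> \<kappa> assms(2,3) by (intro mult_mono powr_mono2) auto
    also have "\<epsilon> powr \<kappa> = \<eta>"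
      using \<kappa> \<open>0 < \<eta>\<close> by (simp add: \<epsilon>_def powr_powr)
    finally show "norm (\<gamma> u - \<gamma> u') \<le> \<eta> * p_var p \<gamma> r v powr (1 / q)"
      by (simp add: z_def)
  qed
qed

section \<open>Riemann-Stieltjes sums\<close>

definition tagged :: "real \<Rightarrow> real \<Rightarrow> real \<Rightarrow> nat \<Rightarrow> (nat \<Rightarrow> real) \<Rightarrow> (nat \<Rightarrow> real) \<Rightarrow> bool" where
  "tagged a b \<delta> n t \<xi> \<longleftrightarrow>
     subdivision a b n t \<and> (\<forall>i<n. t (Suc i) - t i < \<delta> \<and> \<xi> i \<in> {t i..t (Suc i)})"

definition rs_sum ::
    "(real \<Rightarrow> complex) \<Rightarrow> (real \<Rightarrow> complex) \<Rightarrow> nat \<Rightarrow> (nat \<Rightarrow> real) \<Rightarrow> (nat \<Rightarrow> real) \<Rightarrow> complex" where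
  "rs_sum x y n t \<xi> = (\<Sum>i<n. x (\<xi> i) * (y (t (Suc i)) - y (t i)))"

lemma has_young_integral_iff:
  "has_young_integral a b x y I \<longleftrightarrow>
     (\<forall>e>0. \<exists>\<delta>>0. \<forall>n t \<xi>. tagged a b \<delta> n t \<xi> \<longrightarrow> norm (rs_sum x y n t \<xi> - I) < e)"
  unfolding has_young_integral_def tagged_def rs_sum_def by blast

lemma tagged_mono: "tagged a b \<delta> n t \<xi> \<Longrightarrow> \<delta> \<le> \<delta>' \<Longrightarrow> tagged a b \<delta>' n t \<xi>"
  unfolding tagged_def by force

lemma subdivision_list:
  assumes "subdivision a b n t"
  defines "ts \<equiv> map t [0..<Suc n]"
  shows "sorted ts" "ts \<noteq> []" "hd ts = a" "last ts = b" "set ts \<subseteq> {a..b}"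
proof -
  show "ts \<noteq> []"
    by (simp add: ts_def)
  show ends: "hd ts = a" "last ts = b"
    using assms(1) by (auto simp: ts_def subdivision_def hd_map simp del: upt_Suc) simp
  have "successively (\<le>) ts"
    unfolding ts_def successively_map_upt using assms(1) by (auto simp: subdivision_def less_imp_le)
  then show "sorted ts"
    by (simp add: successively_conv_sorted_wrt transp_on_def)
  with ends show "set ts \<subseteq> {a..b}"
    using hd_le_sorted sorted_le_last by fastforce
qed

lemma subdivision_mem:
  assumes "subdivision a b n t" "i \<le> n"
  shows "t i \<in> {a..b}"
proof -
  have "t i \<in> set (map t [0..<Suc n])"
    using assms(2) by (auto simp del: upt_Suc)
  with subdivision_list(5)[OF assms(1)] show ?thesis
    by blast
qed

lemma tagged_exists:
  assumes "a \<le> b" "0 < \<delta>"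
  shows "\<exists>n t. tagged a b \<delta> n t t"
proof (cases "a = b")
  case True
  then show ?thesis
    by (intro exI[of _ 0] exI[of _ "\<lambda>_. a"]) (simp add: tagged_def subdivision_def)
next
  case False
  obtain n where n: "(b - a) / \<delta> < real n"
    using reals_Archimedean2 by blast
  have "0 < (b - a) / \<delta>"
    using False assms by simp
  with n have "0 < n"
    by (cases n) auto
  define d where "d = (b - a) / n"
  define t where "t i = a + real i * d" for i
  have d: "d < \<delta>" "0 < d"
    using n \<open>0 < n\<close> assms False by (auto simp: d_def field_simps)
  have "t (Suc i) = t i + d" for i
    by (simp add: t_def distrib_right)
  with d have step: "t (Suc i) - t i < \<delta>" "t i < t (Suc i)" for i
    by simp_all
  have "t 0 = a" "t n = b"
    using \<open>0 < n\<close> by (auto simp: t_def d_def)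
  then have "tagged a b \<delta> n t t"
    using step by (auto simp: tagged_def subdivision_def less_imp_le)
  then show ?thesis
    by blast
qed

text \<open>
  Moving the tag of an interval to its left end changes a term by a product of two increments
  within that interval.
\<close>
lemma rs_sum_left_sum:
  assumes w: "control a b w" and "1 \<le> \<theta>" "0 \<le> C"
    and xy: "\<And>r v u u' z z'. a \<le> r \<Longrightarrow> v \<le> b \<Longrightarrow> v - r < \<delta> \<Longrightarrow>
        {u, u', z, z'} \<subseteq> {r..v} \<Longrightarrow>
        norm (x u - x u') * norm (y z - y z') \<le> C * w r v powr \<theta>"
    and t: "tagged a b \<delta> n t \<xi>"
  shows "norm (rs_sum x y n t \<xi> - left_sum x y (map t [0..<Suc n])) \<le> C * w a b powr \<theta>"
proof -
  let ?ts = "map t [0..<Suc n]"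
  have sub: "subdivision a b n t"
    using t by (simp add: tagged_def)
  have mem: "t i \<in> {a..b}" if "i \<le> n" for i
    using subdivision_mem[OF sub that] .
  have "norm (x (\<xi> i) - x (t i)) * norm (y (t (Suc i)) - y (t i)) \<le> C * w (t i) (t (Suc i)) powr \<theta>"
    if "i < n" for i
    using t that mem[of i] mem[of "Suc i"] by (intro xy) (auto simp: tagged_def)
  then have "(\<Sum>i<n. norm (x (\<xi> i) - x (t i)) * norm (y (t (Suc i)) - y (t i)))
      \<le> (\<Sum>i<n. C * w (t i) (t (Suc i)) powr \<theta>)"
    by (intro sum_mono) auto
  also have "\<dots> = C * adj_sum (\<lambda>u v. w u v powr \<theta>) ?ts"
    by (simp only: adj_sum_map_upt sum_distrib_left)
  also have "\<dots> \<le> C * w a b powr \<theta>"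
    using adj_sum_control_powr_le[OF w \<open>1 \<le> \<theta>\<close> subdivision_list(1,2,5)[OF sub]]
      subdivision_list(3,4)[OF sub] \<open>0 \<le> C\<close>
    by (intro mult_left_mono) auto
  finally have bound: "(\<Sum>i<n. norm (x (\<xi> i) - x (t i)) * norm (y (t (Suc i)) - y (t i)))
      \<le> C * w a b powr \<theta>" .
  have "rs_sum x y n t \<xi> - left_sum x y ?ts =
      (\<Sum>i<n. (x (\<xi> i) - x (t i)) * (y (t (Suc i)) - y (t i)))"
    unfolding rs_sum_def adj_sum_map_upt by (simp add: sum_subtractf[symmetric] left_diff_distrib)
  then have "norm (rs_sum x y n t \<xi> - left_sum x y ?ts)
      \<le> (\<Sum>i<n. norm (x (\<xi> i) - x (t i)) * norm (y (t (Suc i)) - y (t i)))"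
    by (simp only: norm_mult[symmetric] norm_sum)
  with bound show ?thesis
    by linarith
qed

text \<open>
  Both sums are compared, after their tags are moved to the left ends, with the left sum over the
  common refinement.
\<close>
lemma rs_sums_close:
  assumes w: "control a b w" and \<theta>: "1 < \<theta>" and C: "0 \<le> C" and \<delta>: "0 < \<delta>"
    and xy: "\<And>r v u u' z z'. a \<le> r \<Longrightarrow> v \<le> b \<Longrightarrow> v - r < \<delta> \<Longrightarrow>
        {u, u', z, z'} \<subseteq> {r..v} \<Longrightarrow>
        norm (x u - x u') * norm (y z - y z') \<le> C * w r v powr \<theta>"
    and t: "tagged a b \<delta> n t \<xi>" and t': "tagged a b \<delta> n' t' \<xi>'"
  shows "norm (rs_sum x y n t \<xi> - rs_sum x y n' t' \<xi>')
           \<le> (2 * sewing_const \<theta> + 2) * C * w a b powr \<theta>"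
proof -
  define P P' where "P = map t [0..<Suc n]" and "P' = map t' [0..<Suc n']"
  define Q where "Q = sort (P @ P')"
  have sub: "subdivision a b n t" "subdivision a b n' t'"
    using t t' by (auto simp: tagged_def)
  note P = subdivision_list[OF sub(1), folded P_def]
  note P' = subdivision_list[OF sub(2), folded P'_def]
  have fine: "successively (\<lambda>u v. v - u < \<delta>) P" "successively (\<lambda>u v. v - u < \<delta>) P'"
    using t t' unfolding P_def P'_def successively_map_upt by (auto simp: tagged_def)
  have Q: "sorted Q" "set Q = set P \<union> set P'"
    by (auto simp: Q_def)
  then have Q_ab: "set Q \<subseteq> {a..b}" "Q \<noteq> []"
    using P P' by auto
  have "hd Q = a"
    using sorted_ends(1)[OF Q(1) Q_ab(2,1)] hd_le_sorted[OF Q(1), of a] Q(2) hd_in_set[OF P(2)] P(3)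
    by auto
  have "last Q = b"
    using sorted_ends(3)[OF Q(1) Q_ab(2,1)] sorted_le_last[OF Q(1), of b] Q(2) last_in_set[OF P(2)] P(4)
    by auto
  have close: "norm (left_sum x y Q - left_sum x y R) \<le> sewing_const \<theta> * C * w a b powr \<theta>"
    if R: "sorted R" "R \<noteq> []" "hd R = a" "last R = b" "set R \<subseteq> {a..b}"
      "successively (\<lambda>u v. v - u < \<delta>) R" "set R \<subseteq> set Q" for R
  proof -
    have "norm (left_sum x y Q - left_sum x y R)
        \<le> sewing_const \<theta> * C * adj_sum (\<lambda>u v. w u v powr \<theta>) R"
      using R Q Q_ab \<open>hd Q = a\<close> \<open>last Q = b\<close>
      by (intro left_sum_refine[OF w \<theta> C \<delta>] xy) auto
    also have "\<dots> \<le> sewing_const \<theta> * C * w a b powr \<theta>"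
      using adj_sum_control_powr_le[OF w less_imp_le[OF \<theta>] R(1,2,5)] R(3,4) C sewing_const(1)[OF \<theta>]
      by (intro mult_left_mono) auto
    finally show ?thesis .
  qed
  note tag = rs_sum_left_sum[OF w less_imp_le[OF \<theta>] C xy]
  have mid: "norm (left_sum x y P - left_sum x y P') \<le>
      sewing_const \<theta> * C * w a b powr \<theta> + sewing_const \<theta> * C * w a b powr \<theta>"
    using close[of P] close[of P'] P P' fine Q
    by (intro norm_diff_triangle_le[of _ "left_sum x y Q"]) (auto simp: norm_minus_commute)
  have start: "norm (rs_sum x y n t \<xi> - left_sum x y P) \<le> C * w a b powr \<theta>"
    unfolding P_def using tag[OF _ _ _ _ t] by simp
  have stop: "norm (left_sum x y P' - rs_sum x y n' t' \<xi>') \<le> C * w a b powr \<theta>"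
    unfolding P'_def using tag[OF _ _ _ _ t'] by (simp add: norm_minus_commute)
  from norm_diff_triangle_le[OF norm_diff_triangle_le[OF start mid] stop] show ?thesis
    by (simp add: algebra_simps)
qed

definition rs_cauchy ::
    "real \<Rightarrow> real \<Rightarrow> (real \<Rightarrow> complex) \<Rightarrow> (real \<Rightarrow> complex) \<Rightarrow> real \<Rightarrow> real \<Rightarrow> bool" where
  "rs_cauchy a b x y e \<delta> \<longleftrightarrow>
     (\<forall>n t \<xi> n' t' \<xi>'. tagged a b \<delta> n t \<xi> \<longrightarrow> tagged a b \<delta> n' t' \<xi>' \<longrightarrow>
        norm (rs_sum x y n t \<xi> - rs_sum x y n' t' \<xi>') < e)"

text \<open>
  This bound is all that the integral sees of a Lipschitz function on the image of \<open>\<gamma>\<close>, composed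
  with \<open>\<gamma>\<close>.
\<close>
definition lipschitz_along ::
    "real \<Rightarrow> real \<Rightarrow> real \<Rightarrow> (real \<Rightarrow> 'a::real_normed_vector) \<Rightarrow> (real \<Rightarrow> complex) \<Rightarrow> bool" where
  "lipschitz_along A a b \<gamma> x \<longleftrightarrow>
     (\<forall>u\<in>{a..b}. \<forall>v\<in>{a..b}. norm (x u - x v) \<le> A * norm (\<gamma> u - \<gamma> v))"

text \<open>
  The order of the quantifiers is the point: \<open>\<delta>\<close> depends on the integrand and the integrator only
  through their Lipschitz constants along \<open>\<gamma>\<close>. With \<open>p < q < 2\<close>, a product of two increments is at
  most \<open>A * B * \<eta>\<^sup>2 * w r v powr (2 / q)\<close>, and \<open>2 / q > 1\<close>; so the sums of fine partitions differ by at
  most a constant times \<open>\<eta>\<^sup>2\<close>.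
\<close>
lemma rs_sums_uniformly_cauchy:
  fixes \<gamma> :: "real \<Rightarrow> 'a::real_normed_vector"
  assumes "a \<le> b" "1 \<le> p" "p < 2" and cont: "continuous_on {a..b} \<gamma>"
    and var: "finite_p_variation p a b \<gamma>" and "0 \<le> A" "0 \<le> B" "0 < e"
  shows "\<exists>\<delta>>0. \<forall>x y. lipschitz_along A a b \<gamma> x \<longrightarrow> lipschitz_along B a b \<gamma> y \<longrightarrow>
           rs_cauchy a b x y e \<delta>"
proof -
  \<comment> \<open>Any exponent strictly between \<open>p\<close> and \<open>2\<close> would serve.\<close>
  define q where "q = (p + 2) / 2"
  define \<theta> where "\<theta> = 2 / q"
  have q: "p < q" "q < 2" "0 < q"
    using assms by (auto simp: q_def)
  then have \<theta>: "1 < \<theta>"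
    by (simp add: \<theta>_def)
  define w where "w = p_var p \<gamma>"
  have w: "control a b w"
    unfolding w_def by (rule control_p_var[OF var])
  define M where "M = (2 * sewing_const \<theta> + 2) * (A * B) * w a b powr \<theta>"
  have M: "0 \<le> M"
    using sewing_const(1)[OF \<theta>] assms by (simp add: M_def)
  \<comment> \<open>Chosen so that \<open>M * \<eta>\<^sup>2 < e\<close>, also when \<open>M = 0\<close>.\<close>
  define \<eta> where "\<eta> = sqrt (e / (M + 1))"
  have \<eta>: "0 < \<eta>" "\<eta>\<^sup>2 = e / (M + 1)"
    using M \<open>0 < e\<close> by (auto simp: \<eta>_def)
  obtain \<delta> where "0 < \<delta>" and small:
    "\<And>r v u u'. a \<le> r \<Longrightarrow> v \<le> b \<Longrightarrow> v - r < \<delta> \<Longrightarrow> u \<in> {r..v} \<Longrightarrow> u' \<in> {r..v} \<Longrightarrow>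
       norm (\<gamma> u - \<gamma> u') \<le> \<eta> * w r v powr (1 / q)"
    using small_increments[OF var \<open>1 \<le> p\<close> q(1) cont \<eta>(1)] unfolding w_def by metis
  have "rs_cauchy a b x y e \<delta>"
    if x: "lipschitz_along A a b \<gamma> x" and y: "lipschitz_along B a b \<gamma> y" for x y
    unfolding rs_cauchy_def
  proof (intro allI impI)
    fix n t \<xi> n' t' \<xi>'
    assume t: "tagged a b \<delta> n t \<xi>" "tagged a b \<delta> n' t' \<xi>'"
    have "norm (rs_sum x y n t \<xi> - rs_sum x y n' t' \<xi>')
           \<le> (2 * sewing_const \<theta> + 2) * (A * B * \<eta>\<^sup>2) * w a b powr \<theta>"
    proof (rule rs_sums_close[OF w \<theta> _ \<open>0 < \<delta>\<close> _ t])
      show "0 \<le> A * B * \<eta>\<^sup>2"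
        using assms by simp
      fix r v u u' z z'
      assume rv: "a \<le> r" "v \<le> b" "v - r < \<delta>" and mem: "{u, u', z, z'} \<subseteq> {r..v}"
      have "norm (x u - x u') \<le> A * norm (\<gamma> u - \<gamma> u')"
        using x rv mem by (auto simp: lipschitz_along_def)
      also have "\<dots> \<le> A * (\<eta> * w r v powr (1 / q))"
        using small[OF rv, of u u'] mem \<open>0 \<le> A\<close> by (intro mult_left_mono) auto
      finally have 1: "norm (x u - x u') \<le> A * (\<eta> * w r v powr (1 / q))" .
      have "norm (y z - y z') \<le> B * norm (\<gamma> z - \<gamma> z')"
        using y rv mem by (auto simp: lipschitz_along_def)
      also have "\<dots> \<le> B * (\<eta> * w r v powr (1 / q))"
        using small[OF rv, of z z'] mem \<open>0 \<le> B\<close> by (intro mult_left_mono) auto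
      finally have 2: "norm (y z - y z') \<le> B * (\<eta> * w r v powr (1 / q))" .
      have "norm (x u - x u') * norm (y z - y z')
          \<le> (A * (\<eta> * w r v powr (1 / q))) * (B * (\<eta> * w r v powr (1 / q)))"
        using 1 2 \<eta>(1) \<open>0 \<le> A\<close> by (intro mult_mono) auto
      also have "\<dots> = A * B * \<eta>\<^sup>2 * (w r v powr (1 / q) * w r v powr (1 / q))"
        by (simp add: power2_eq_square)
      also have "w r v powr (1 / q) * w r v powr (1 / q) = w r v powr \<theta>"
        by (simp add: \<theta>_def flip: powr_add)
      finally show "norm (x u - x u') * norm (y z - y z') \<le> A * B * \<eta>\<^sup>2 * w r v powr \<theta>" .
    qed
    also have "\<dots> = M * e / (M + 1)"
      by (simp add: M_def \<eta>(2))
    also have "\<dots> < e"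
      using M \<open>0 < e\<close> by (simp add: field_simps)
    finally show "norm (rs_sum x y n t \<xi> - rs_sum x y n' t' \<xi>') < e" .
  qed
  with \<open>0 < \<delta>\<close> show ?thesis
    by blast
qed

section \<open>The Young integral\<close>

lemma has_young_integral_unique:
  assumes "a \<le> b" "has_young_integral a b x y I" "has_young_integral a b x y J"
  shows "I = J"
proof (rule ccontr)
  assume "I \<noteq> J"
  define e where "e = norm (I - J) / 2"
  have "0 < e"
    using \<open>I \<noteq> J\<close> by (simp add: e_def)
  obtain \<delta> where \<delta>: "0 < \<delta>" "\<And>n t \<xi>. tagged a b \<delta> n t \<xi> \<Longrightarrow> norm (rs_sum x y n t \<xi> - I) < e"
    using assms(2) \<open>0 < e\<close> unfolding has_young_integral_iff by blast
  obtain \<delta>' where \<delta>': "0 < \<delta>'" "\<And>n t \<xi>. tagged a b \<delta>' n t \<xi> \<Longrightarrow> norm (rs_sum x y n t \<xi> - J) < e"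
    using assms(3) \<open>0 < e\<close> unfolding has_young_integral_iff by blast
  obtain n t where t: "tagged a b (min \<delta> \<delta>') n t t"
    using tagged_exists[OF \<open>a \<le> b\<close>, of "min \<delta> \<delta>'"] \<delta>(1) \<delta>'(1) by auto
  have "norm (rs_sum x y n t t - I) < e" "norm (rs_sum x y n t t - J) < e"
    using \<delta>(2) \<delta>'(2) tagged_mono[OF t] by auto
  then have "norm (I - J) < e + e"
    by (metis norm_diff_triangle_less norm_minus_commute)
  then show False
    by (simp add: e_def)
qed

lemma young_integral_eq:
  assumes "a \<le> b" "has_young_integral a b x y I"
  shows "young_integral a b x y = I"
  unfolding young_integral_def using assms has_young_integral_unique by blast

text \<open>
  Besides existence, the second part records that the mesh witnessing the Cauchy property for \<open>e\<close>
  also bounds the distance to the integral by \<open>e\<close>. Hence uniform Cauchy bounds give uniform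
  convergence.
\<close>
lemma has_young_integral_if_cauchy:
  assumes "a \<le> b" and cauchy: "\<And>e. 0 < e \<Longrightarrow> \<exists>\<delta>>0. rs_cauchy a b x y e \<delta>"
  shows "has_young_integral a b x y (young_integral a b x y)"
    and "\<And>e \<delta> n t \<xi>. rs_cauchy a b x y e \<delta> \<Longrightarrow> 0 < \<delta> \<Longrightarrow> tagged a b \<delta> n t \<xi> \<Longrightarrow>
           norm (rs_sum x y n t \<xi> - young_integral a b x y) \<le> e"
proof -
  have "\<forall>m. \<exists>n t. tagged a b (1 / real (Suc m)) n t t"
    using tagged_exists[OF \<open>a \<le> b\<close>] by simp
  then obtain n t where nt: "\<And>m. tagged a b (1 / real (Suc m)) (n m) (t m) (t m)"
    by metis
  define S where "S m = rs_sum x y (n m) (t m) (t m)" for m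
  have fine: "\<exists>N. \<forall>m\<ge>N. tagged a b \<delta> (n m) (t m) (t m)" if "0 < \<delta>" for \<delta>
  proof -
    obtain N where N: "1 / real (Suc N) < \<delta>"
      using nat_approx_posE[OF \<open>0 < \<delta>\<close>] by blast
    have "tagged a b \<delta> (n m) (t m) (t m)" if "N \<le> m" for m
    proof (rule tagged_mono[OF nt])
      have "1 / real (Suc m) \<le> 1 / real (Suc N)"
        using that by (simp add: frac_le)
      with N show "1 / real (Suc m) \<le> \<delta>"
        by linarith
    qed
    then show ?thesis
      by blast
  qed
  have "Cauchy S"
  proof (rule CauchyI)
    fix e :: real assume "0 < e"
    then obtain \<delta> where "0 < \<delta>" "rs_cauchy a b x y e \<delta>"
      using cauchy by blast
    moreover obtain N where "\<And>m. m \<ge> N \<Longrightarrow> tagged a b \<delta> (n m) (t m) (t m)"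
      using fine[OF \<open>0 < \<delta>\<close>] by blast
    ultimately have "\<forall>m\<ge>N. \<forall>n\<ge>N. norm (S m - S n) < e"
      unfolding rs_cauchy_def S_def by simp
    then show "\<exists>M. \<forall>m\<ge>M. \<forall>n\<ge>M. norm (S m - S n) < e"
      by blast
  qed
  then obtain I where I: "S \<longlonglongrightarrow> I"
    by (meson Cauchy_convergent_iff convergent_def)
  have rate: "norm (rs_sum x y k \<tau> \<xi> - I) \<le> e"
    if "rs_cauchy a b x y e \<delta>" "0 < \<delta>" "tagged a b \<delta> k \<tau> \<xi>" for e \<delta> k \<tau> \<xi>
  proof -
    obtain N where N: "\<And>m. m \<ge> N \<Longrightarrow> tagged a b \<delta> (n m) (t m) (t m)"
      using fine[OF \<open>0 < \<delta>\<close>] by blast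
    have "norm (rs_sum x y k \<tau> \<xi> - S m) \<le> e" if "N \<le> m" for m
      using \<open>rs_cauchy a b x y e \<delta>\<close> \<open>tagged a b \<delta> k \<tau> \<xi>\<close> N[OF that]
      unfolding rs_cauchy_def S_def by (intro less_imp_le) simp
    moreover have "(\<lambda>m. norm (rs_sum x y k \<tau> \<xi> - S m)) \<longlonglongrightarrow> norm (rs_sum x y k \<tau> \<xi> - I)"
      by (intro tendsto_intros I)
    ultimately show ?thesis
      by (intro Lim_bounded) auto
  qed
  have has: "has_young_integral a b x y I"
    unfolding has_young_integral_iff
  proof (intro allI impI)
    fix e :: real assume "0 < e"
    then obtain \<delta> where \<delta>: "0 < \<delta>" "rs_cauchy a b x y (e / 2) \<delta>"
      using cauchy[of "e / 2"] by auto
    then have "norm (rs_sum x y n t \<xi> - I) < e" if "tagged a b \<delta> n t \<xi>" for n t \<xi>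
      using rate[OF \<delta>(2,1) that] \<open>0 < e\<close> by linarith
    with \<delta>(1) show "\<exists>\<delta>>0. \<forall>n t \<xi>. tagged a b \<delta> n t \<xi> \<longrightarrow> norm (rs_sum x y n t \<xi> - I) < e"
      by blast
  qed
  have I_eq: "young_integral a b x y = I"
    by (rule young_integral_eq[OF \<open>a \<le> b\<close> has])
  show "has_young_integral a b x y (young_integral a b x y)"
    using has by (simp add: I_eq)
  show "norm (rs_sum x y n t \<xi> - young_integral a b x y) \<le> e"
    if "rs_cauchy a b x y e \<delta>" "0 < \<delta>" "tagged a b \<delta> n t \<xi>" for e \<delta> n t \<xi>
    unfolding I_eq by (rule rate[OF that])
qed

text \<open>
  For a fixed tagged subdivision the Riemann-Stieltjes sum is a finite combination of entire functions
  of \<open>s\<close>. On bounded sets of \<open>s\<close> the integrands share a Lipschitz constant along \<open>\<gamma>\<close>, so these sums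
  converge uniformly there, and locally uniform limits of holomorphic functions are holomorphic.
\<close>
lemma young_integral_entire:
  fixes \<gamma> :: "real \<Rightarrow> 'a::real_normed_vector" and x :: "complex \<Rightarrow> real \<Rightarrow> complex"
  assumes "a \<le> b" "1 \<le> p" "p < 2" and cont: "continuous_on {a..b} \<gamma>"
    and var: "finite_p_variation p a b \<gamma>"
    and hol: "\<And>u. u \<in> {a..b} \<Longrightarrow> (\<lambda>s. x s u) holomorphic_on UNIV"
    and lip: "\<And>R. \<exists>A\<ge>0. \<forall>s\<in>ball 0 R. lipschitz_along A a b \<gamma> (x s)"
    and y: "0 \<le> B" "lipschitz_along B a b \<gamma> y"
  shows "young_integrable a b (x s) y"
    and "(\<lambda>s. young_integral a b (x s) y) holomorphic_on UNIV"
proof -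
  have unif: "\<exists>\<delta>>0. \<forall>s\<in>ball 0 R. rs_cauchy a b (x s) y e \<delta>" if "0 < e" for R e
  proof -
    obtain A where "0 \<le> A" and A: "\<And>s. s \<in> ball 0 R \<Longrightarrow> lipschitz_along A a b \<gamma> (x s)"
      using lip by blast
    from rs_sums_uniformly_cauchy[OF assms(1-3) cont var \<open>0 \<le> A\<close> y(1) \<open>0 < e\<close>]
    show ?thesis
      using A y(2) by blast
  qed
  have cauchy: "\<exists>\<delta>>0. rs_cauchy a b (x s) y e \<delta>" if "0 < e" for e s
    using unif[OF that, of "norm s + 1"] by fastforce
  note integral = has_young_integral_if_cauchy[OF \<open>a \<le> b\<close> cauchy]
  show "young_integrable a b (x s) y"
    unfolding young_integrable_def using integral(1) by blast
  have "\<forall>m. \<exists>n t. tagged a b (1 / real (Suc m)) n t t"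
    using tagged_exists[OF \<open>a \<le> b\<close>] by simp
  then obtain n t where nt: "\<And>m. tagged a b (1 / real (Suc m)) (n m) (t m) (t m)"
    by metis
  define S where "S m s = rs_sum (x s) y (n m) (t m) (t m)" for m s
  show "(\<lambda>s. young_integral a b (x s) y) holomorphic_on UNIV"
  proof (rule holomorphic_uniform_sequence[OF open_UNIV])
    fix m
    have "t m i \<in> {a..b}" if "i < n m" for i
      using nt[of m] that by (intro subdivision_mem) (auto simp: tagged_def)
    then show "S m holomorphic_on UNIV"
      unfolding S_def rs_sum_def by (intro holomorphic_intros hol) auto
  next
    fix z :: complex
    have "uniform_limit (cball z 1) S (\<lambda>s. young_integral a b (x s) y) sequentially"
    proof (rule uniform_limitI)
      fix e :: real assume "0 < e"
      then obtain \<delta> where "0 < \<delta>"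
        and \<delta>: "\<And>s. s \<in> ball 0 (norm z + 2) \<Longrightarrow> rs_cauchy a b (x s) y (e / 2) \<delta>"
        using unif[of "e / 2" "norm z + 2"] by auto
      have "\<forall>\<^sub>F m in sequentially. 1 / real (Suc m) < \<delta>"
        using order_tendstoD(2)[OF LIMSEQ_inverse_real_of_nat \<open>0 < \<delta>\<close>] by (simp add: inverse_eq_divide)
      then show "\<forall>\<^sub>F m in sequentially. \<forall>s\<in>cball z 1. dist (S m s) (young_integral a b (x s) y) < e"
      proof eventually_elim
        case (elim m)
        show ?case
        proof
          fix s assume "s \<in> cball z 1"
          then have "norm (s - z) \<le> 1"
            by (simp add: dist_norm norm_minus_commute)
          then have "s \<in> ball 0 (norm z + 2)"
            using norm_triangle_ineq[of "s - z" z] by simp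
          from integral(2)[OF _ \<delta>[OF this] \<open>0 < \<delta>\<close> tagged_mono[OF nt less_imp_le[OF elim]]]
          show "dist (S m s) (young_integral a b (x s) y) < e"
            using \<open>0 < e\<close> by (simp add: S_def dist_norm)
        qed
      qed
    qed
    then show "\<exists>d. 0 < d \<and> cball z d \<subseteq> UNIV \<and>
        uniform_limit (cball z d) S (\<lambda>s. young_integral a b (x s) y) sequentially"
      by (intro exI[of _ 1]) auto
  qed
qed

section \<open>Lipschitz bounds for the integrand\<close>

text \<open>
  For nearby points \<open>w\<close>, \<open>w'\<close> of \<open>W\<close>, uniform continuity makes \<open>z = L w - L w'\<close> small, and then
  \<open>norm z \<le> 2 * norm (exp z - 1)\<close> where \<open>exp z - 1 = (w - w') * exp (- L w')\<close>. For points at distance at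
  least \<open>\<delta>\<close> the boundedness of \<open>L\<close> suffices.
\<close>
lemma log_branch_lipschitz:
  assumes "compact W" "log_branch_on W L"
  shows "\<exists>C. C-lipschitz_on W L"
proof -
  have cont: "continuous_on W L" and exp: "\<And>w. w \<in> W \<Longrightarrow> exp (L w) = w"
    using assms(2) by (auto simp: log_branch_on_def)
  obtain M where M: "\<And>w. w \<in> W \<Longrightarrow> norm (L w) \<le> M" "0 < M"
    using compact_imp_bounded[OF compact_continuous_image[OF cont \<open>compact W\<close>]]
    by (auto simp: bounded_pos)
  obtain \<delta> where \<delta>: "0 < \<delta>"
    "\<And>w w'. w \<in> W \<Longrightarrow> w' \<in> W \<Longrightarrow> dist w w' < \<delta> \<Longrightarrow> dist (L w) (L w') < 1 / 2"
    using compact_uniformly_continuous[OF cont \<open>compact W\<close>]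
    unfolding uniformly_continuous_on_def by (metis half_gt_zero zero_less_one)
  define C where "C = max (2 * exp M) (2 * M / \<delta>)"
  have "dist (L w) (L w') \<le> C * dist w w'" if w: "w \<in> W" "w' \<in> W" for w w'
  proof (cases "dist w w' < \<delta>")
    case True
    define z where "z = L w - L w'"
    have "norm z \<le> 1 / 2"
      using \<delta>(2)[OF w True] by (simp add: z_def dist_norm)
    have "w' \<noteq> 0"
      using exp[OF w(2)] by (metis exp_not_eq_zero)
    have "norm z \<le> 2 * norm (exp z - 1)"
      using norm_exp_bounds(1)[OF \<open>norm z \<le> 1 / 2\<close>] by simp
    also have "exp z - 1 = (w - w') * exp (- L w')"
      using exp[OF w(1)] exp[OF w(2)] \<open>w' \<noteq> 0\<close>
      by (simp add: z_def exp_diff exp_minus field_simps)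
    also have "2 * norm ((w - w') * exp (- L w')) \<le> 2 * exp M * norm (w - w')"
    proof -
      have "norm (exp (- L w')) \<le> exp (norm (- L w'))"
        by (rule norm_exp)
      also have "\<dots> \<le> exp M"
        using M(1)[OF w(2)] by simp
      finally have "norm (w - w') * norm (exp (- L w')) \<le> norm (w - w') * exp M"
        by (rule mult_left_mono) simp
      then show ?thesis
        by (simp add: norm_mult mult_ac)
    qed
    also have "\<dots> \<le> C * norm (w - w')"
      unfolding C_def by (intro mult_right_mono) auto
    finally show ?thesis
      by (simp add: z_def dist_norm)
  next
    case False
    have "dist (L w) (L w') \<le> 2 * M"
      using M(1)[OF w(1)] M(1)[OF w(2)] norm_triangle_ineq4[of "L w" "L w'"] by (simp add: dist_norm)
    also have "2 * M = 2 * M / \<delta> * \<delta>"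
      using \<open>0 < \<delta>\<close> by simp
    also have "\<dots> \<le> C * dist w w'"
      using False M(2) \<delta>(1) unfolding C_def by (intro mult_mono) (auto simp: le_max_iff_disj)
    finally show ?thesis .
  qed
  moreover have "0 \<le> C"
    using M(2) by (simp add: C_def le_max_iff_disj)
  ultimately have "C-lipschitz_on W L"
    by (intro lipschitz_onI)
  then show ?thesis
    by blast
qed

text \<open>
  The constant bounds the derivative \<open>(k * z ^ (k - 1) + s * z ^ k) * exp (s * z)\<close> on the disc of
  radius \<open>M\<close>, uniformly for \<open>norm s \<le> R\<close>.
\<close>
lemma E_fun_lipschitz:
  assumes "norm s \<le> R" "norm z \<le> M" "norm z' \<le> M"
  shows "norm (E_fun k s z - E_fun k s z')
           \<le> (real k * M ^ (k - 1) + R * M ^ k) * exp (R * M) * norm (z - z')"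
proof (rule field_differentiable_bound[OF convex_cball[of 0 M]])
  fix z :: complex assume "z \<in> cball 0 M"
  then have z: "norm z \<le> M"
    by simp
  have R: "0 \<le> R"
    using norm_ge_zero[of s] assms(1) by linarith
  have M: "0 \<le> M"
    using norm_ge_zero[of z] z by linarith
  have "norm (s * z) \<le> R * M"
    unfolding norm_mult using assms z R by (intro mult_mono) auto
  then have exp: "norm (exp (s * z)) \<le> exp (R * M)"
    using norm_exp[of "s * z"] by (meson exp_le_cancel_iff order_trans)
  show "((\<lambda>z. E_fun k s z) has_field_derivative
      (of_nat k * z ^ (k - 1) + s * z ^ k) * exp (s * z)) (at z within cball 0 M)"
    unfolding E_fun_def by (auto intro!: derivative_eq_intros simp: algebra_simps)
  have "norm (of_nat k * z ^ (k - 1) + s * z ^ k) \<le> real k * M ^ (k - 1) + R * M ^ k"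
    using z R M assms(1)
    by (intro norm_triangle_mono) (auto simp: norm_mult norm_power intro!: mult_mono power_mono)
  with exp show "norm ((of_nat k * z ^ (k - 1) + s * z ^ k) * exp (s * z))
      \<le> (real k * M ^ (k - 1) + R * M ^ k) * exp (R * M)"
    unfolding norm_mult using R M by (intro mult_mono) auto
qed (use assms in auto)

lemma lipschitz_along_compose:
  assumes "C-lipschitz_on (\<gamma> ` {a..b}) F"
  shows "lipschitz_along C a b \<gamma> (F \<circ> \<gamma>)"
  using lipschitz_on_normD[OF assms] by (auto simp: lipschitz_along_def)

lemma lipschitz_along_mult:
  assumes "lipschitz_along A a b \<gamma> x" "lipschitz_along B a b \<gamma> y"
    and "\<And>u. u \<in> {a..b} \<Longrightarrow> norm (x u) \<le> X" "\<And>u. u \<in> {a..b} \<Longrightarrow> norm (y u) \<le> Y" "0 \<le> X" "0 \<le> A"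
  shows "lipschitz_along (A * Y + X * B) a b \<gamma> (\<lambda>u. x u * y u)"
  unfolding lipschitz_along_def
proof (intro ballI)
  fix u v assume uv: "u \<in> {a..b}" "v \<in> {a..b}"
  have "x u * y u - x v * y v = (x u - x v) * y u + x v * (y u - y v)"
    by (simp add: algebra_simps)
  also have "norm \<dots> \<le> A * norm (\<gamma> u - \<gamma> v) * Y + X * (B * norm (\<gamma> u - \<gamma> v))"
    using assms uv unfolding lipschitz_along_def
    by (intro norm_triangle_mono) (auto simp: norm_mult intro!: mult_mono)
  finally show "norm (x u * y u - x v * y v) \<le> (A * Y + X * B) * norm (\<gamma> u - \<gamma> v)"
    by (simp add: algebra_simps)
qed

section \<open>Holomorphy in the exponent\<close>

theorem theorem2p3:
  fixes \<gamma> :: "real \<Rightarrow> 'a::euclidean_space"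
    and f g h :: "'a \<Rightarrow> complex"
    and L :: "complex \<Rightarrow> complex"
    and p T :: real
    and k :: nat
  assumes "0 \<le> T"
    and "1 \<le> p" and "p < 2"
    and "continuous_on {0..T} \<gamma>"
    and "finite_p_variation p 0 T \<gamma>"
    and "\<exists>C. C-lipschitz_on (\<gamma> ` {0..T}) f"
    and "\<exists>C. C-lipschitz_on (\<gamma> ` {0..T}) g"
    and "\<exists>C. C-lipschitz_on (\<gamma> ` {0..T}) h"
    and "0 \<notin> convex hull (f ` \<gamma> ` {0..T})"
    and "log_branch_on (f ` \<gamma> ` {0..T}) L"
  shows "(\<forall>s. path_integrable T \<gamma> (\<lambda>v. L (f v) ^ k * branch_power L f s v * g v) h) \<and>
         (\<forall>s. I_int T \<gamma> L f (E_fun k s) g h =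
              path_integral T \<gamma> (\<lambda>v. L (f v) ^ k * branch_power L f s v * g v) h) \<and>
         (\<lambda>s. I_int T \<gamma> L f (E_fun k s) g h) holomorphic_on UNIV"
proof -
  define K where "K = \<gamma> ` {0..T}"
  define l where "l = L \<circ> f"
  define x where "x s u = E_fun k s (l (\<gamma> u)) * g (\<gamma> u)" for s u
  obtain Cf Cg Ch where lip: "Cf-lipschitz_on K f" "Cg-lipschitz_on K g" "Ch-lipschitz_on K h"
    using assms by (auto simp: K_def)
  have "compact K"
    unfolding K_def using assms(4) by (intro compact_continuous_image) auto
  have "compact (f ` K)"
    using \<open>compact K\<close> lipschitz_on_continuous_on[OF lip(1)] by (rule compact_continuous_image[rotated])
  then obtain CL where "CL-lipschitz_on (f ` K) L"
    using log_branch_lipschitz assms(10) unfolding K_def by blast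
  then have l: "(CL * Cf)-lipschitz_on K l"
    unfolding l_def using lip(1) by (intro lipschitz_on_compose)
  define Cl where "Cl = CL * Cf"
  have "0 \<le> Cl" "0 \<le> Ch"
    using lipschitz_on_nonneg[OF l] lipschitz_on_nonneg[OF lip(3)] by (auto simp: Cl_def)
  obtain M where M: "0 < M" "\<And>v. v \<in> K \<Longrightarrow> norm (l v) \<le> M"
    using compact_imp_bounded[OF compact_continuous_image[OF lipschitz_on_continuous_on[OF l] \<open>compact K\<close>]]
    by (auto simp: bounded_pos)
  obtain G where G: "0 < G" "\<And>v. v \<in> K \<Longrightarrow> norm (g v) \<le> G"
    using compact_imp_bounded[OF compact_continuous_image[OF lipschitz_on_continuous_on[OF lip(2)] \<open>compact K\<close>]]
    by (auto simp: bounded_pos)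
  have x_lip: "\<exists>A\<ge>0. \<forall>s\<in>ball 0 R. lipschitz_along A 0 T \<gamma> (x s)" for R :: real
  proof (cases "0 < R")
    case True
    define D where "D = (real k * M ^ (k - 1) + R * M ^ k) * exp (R * M)"
    define X where "X = M ^ k * exp (R * M)"
    have nonneg: "0 \<le> D" "0 \<le> X" "0 \<le> Cg"
      using True M(1) lipschitz_on_nonneg[OF lip(2)] by (auto simp: D_def X_def)
    have "lipschitz_along (D * Cl * G + X * Cg) 0 T \<gamma> (x s)" if "s \<in> ball 0 R" for s
      unfolding x_def
    proof (rule lipschitz_along_mult)
      have s: "norm s \<le> R"
        using that by simp
      show "lipschitz_along (D * Cl) 0 T \<gamma> (\<lambda>u. E_fun k s (l (\<gamma> u)))"
        unfolding lipschitz_along_def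
      proof (intro ballI)
        fix u v assume "u \<in> {0..T}" "v \<in> {0..T}"
        then have K: "\<gamma> u \<in> K" "\<gamma> v \<in> K"
          by (auto simp: K_def)
        have "norm (E_fun k s (l (\<gamma> u)) - E_fun k s (l (\<gamma> v))) \<le> D * norm (l (\<gamma> u) - l (\<gamma> v))"
          unfolding D_def by (rule E_fun_lipschitz[OF s M(2)[OF K(1)] M(2)[OF K(2)]])
        also have "\<dots> \<le> D * (Cl * norm (\<gamma> u - \<gamma> v))"
          using lipschitz_on_normD[OF l K] nonneg by (intro mult_left_mono) (auto simp: Cl_def)
        finally show "norm (E_fun k s (l (\<gamma> u)) - E_fun k s (l (\<gamma> v))) \<le> D * Cl * norm (\<gamma> u - \<gamma> v)"
          by (simp add: mult.assoc)
      qed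
      show "lipschitz_along Cg 0 T \<gamma> (\<lambda>u. g (\<gamma> u))"
        using lipschitz_along_compose[OF lip(2)[unfolded K_def]] by (simp add: comp_def)
      show "norm (g (\<gamma> u)) \<le> G" if "u \<in> {0..T}" for u
        using G(2) that by (simp add: K_def)
      show "norm (E_fun k s (l (\<gamma> u))) \<le> X" if "u \<in> {0..T}" for u
      proof -
        have lu: "norm (l (\<gamma> u)) \<le> M"
          using M(2) that by (simp add: K_def)
        then have "norm (s * l (\<gamma> u)) \<le> R * M"
          unfolding norm_mult using s True by (intro mult_mono) auto
        then have "norm (exp (s * l (\<gamma> u))) \<le> exp (R * M)"
          using norm_exp[of "s * l (\<gamma> u)"] by (meson exp_le_cancel_iff order_trans)
        then show ?thesis
          unfolding E_fun_def X_def norm_mult norm_power using lu M(1)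
          by (intro mult_mono power_mono) auto
      qed
    qed (use nonneg \<open>0 \<le> Cl\<close> in auto)
    moreover have "0 \<le> D * Cl * G + X * Cg"
      using nonneg \<open>0 \<le> Cl\<close> G(1) by simp
    ultimately show ?thesis
      by blast
  next
    case False
    then have "ball 0 R = ({} :: complex set)"
      by simp
    then show ?thesis
      by (metis empty_iff order_refl)
  qed
  have x_hol: "(\<lambda>s. x s u) holomorphic_on UNIV" for u
    unfolding x_def E_fun_def by (intro holomorphic_intros)
  note entire = young_integral_entire[OF assms(1-5) x_hol x_lip \<open>0 \<le> Ch\<close>
      lipschitz_along_compose[OF lip(3)[unfolded K_def]]]
  have integrand: "(\<lambda>v. L (f v) ^ k * branch_power L f s v * g v) \<circ> \<gamma> = x s"
    and E_integrand: "(\<lambda>v. (E_fun k s \<circ> L \<circ> f) v * g v) \<circ> \<gamma> = x s" for s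
    by (auto simp: x_def l_def E_fun_def branch_power_def)
  show ?thesis
    unfolding path_integrable_def I_int_def path_integral_def integrand E_integrand
    using entire by simp
qed

end
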